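(* Suppose that for every integer $n>5040$ there is a positive integer $x$ such that $X(nx)>X(n)$. Then $X(n)<e^{\gamma}$ for every integer $n>5040$.
   Context: For an integer $m\ge 2$, $\sigma(m)$ denotes the sum of the positive divisors of $m$ and $X(m):=\frac{\sigma(m)}{m\ln\ln m}$. $\gamma$ is the Euler–Mascheroni constant. *)

theory Defs
  imports "HOL-Analysis.Analysis"
begin

(* Junk value sigma 0 = 0 (sum over an infinite set); only used for m >= 2. *)
definition sigma :: "nat \<Rightarrow> nat" where
  "sigma m = (\<Sum>d | d dvd m. d)"

(* Meaningful for m >= 2. *)
definition X :: "nat \<Rightarrow> real" where
  "X m = real (sigma m) / (real m * ln (ln (real m)))"

end

theory Submission
  imports Defs "HOL-Computational_Algebra.Primes" "HOL-Library.Discrete_Functions"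
    "HOL-Real_Asymp.Real_Asymp"
begin

text \<open>
  By the upper half of Gronwall's theorem, \<open>limsup X \<le> exp \<gamma>\<close>. If \<open>X n \<ge> exp \<gamma>\<close> for some \<open>n > 5040\<close>,
  then \<open>c = X (n * x) > exp \<gamma>\<close> for some \<open>x\<close>, so only finitely many \<open>m\<close> have \<open>X m \<ge> c\<close>;
  at a maximum of \<open>X\<close> among those with \<open>m > 5040\<close> the hypothesis fails.

  Gronwall's bound follows from \<open>\<sigma>(n)/n \<le> (\<Prod>p|n. 1 / (1 - 1/p))\<close>: the primes \<open>p > ln n\<close> contribute
  \<open>1 + o(1)\<close>, and the others are controlled by the upper half of Mertens' third theorem.

  For the latter, the primes with weight \<open>1/p\<close> are compared with the powers \<open>2^k\<close> with weight \<open>1/k\<close>.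
  By Mertens' first theorem the difference \<open>T n\<close> of the two counting functions satisfies
  \<open>T m \<ge> T n - O(1 / ln n)\<close> for \<open>m \<ge> n\<close>, so \<open>T n\<close> is at most its Dirichlet mean with
  weights \<open>d^(-s)\<close> as \<open>s \<rightarrow> 0\<close>, up to \<open>O(1 / ln n)\<close>. That mean is evaluated by the Euler product bound
  \<open>\<zeta>(1 + s) \<le> 1 + 1/s\<close> and by \<open>(\<Sum>k. 2^(-k s) / k) = - ln (1 - 2^(-s))\<close>.
\<close>

section \<open>Chebyshev's bound and Mertens' first theorem\<close>

text \<open>Row \<open>2 * m + 1\<close> has two equal middle entries, and the whole row sums to
  \<open>2 * 4 ^ m\<close>.\<close>

lemma binomial_odd_le: "(2 * m + 1 choose m) \<le> (4::nat) ^ m"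
proof -
  have "(2 * m + 1 choose Suc m) = (2 * m + 1 choose m)"
    using central_binomial_odd[of "2 * m + 1"] by simp
  then have "2 * (2 * m + 1 choose m) = (\<Sum>k\<in>{m, Suc m}. 2 * m + 1 choose k)"
    by simp
  also have "\<dots> \<le> (\<Sum>k\<le>2 * m + 1. 2 * m + 1 choose k)"
    by (rule sum_mono2) auto
  also have "\<dots> = 2 * 4 ^ m"
    by (subst choose_row_sum) (simp add: power_mult)
  finally show ?thesis by simp
qed

text \<open>Erdos' argument. An even \<open>n > 2\<close> adds no prime. For
  \<open>n = 2 * m + 1\<close>, every prime in \<open>(m + 1, n]\<close> divides
  \<open>fact n\<close> but neither \<open>fact m\<close> nor \<open>fact (Suc m)\<close>, so the
  product of these primes divides \<open>n choose m\<close>, which is at most \<open>4 ^ m\<close>;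
  induction at \<open>m + 1\<close> covers the remaining primes.\<close>

lemma prod_primes_le: "\<Prod>{p. prime p \<and> p \<le> n} \<le> (4::nat) ^ n"
proof (induction n rule: less_induct)
  case (less n)
  show ?case
  proof (cases "n \<le> 2")
    case True
    have "{p. prime p \<and> p \<le> n} \<subseteq> {2}"
      using True prime_ge_2_nat by (auto intro: le_antisym)
    then have "{p. prime p \<and> p \<le> n} = {} \<or> 2 \<le> n \<and> {p. prime p \<and> p \<le> n} = {2}"
      by (auto simp: subset_singleton_iff)
    then show ?thesis
    proof
      assume "2 \<le> n \<and> {p. prime p \<and> p \<le> n} = {2}"
      then show ?thesis using power_increasing[of 2 n "4::nat"] by simp
    qed (simp only: prod.empty one_le_power)
  next
    case False
    show ?thesis
    proof (cases "even n")
      case True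
      have "\<not> prime n" using True False primes_dvd_imp_eq two_is_prime_nat by blast
      then have "p \<le> n \<longleftrightarrow> p \<le> n - 1" if "prime p" for p
        using that by (cases "p = n") auto
      then have "{p. prime p \<and> p \<le> n} = {p. prime p \<and> p \<le> n - 1}" by blast
      then have "\<Prod>{p. prime p \<and> p \<le> n} \<le> 4 ^ (n - 1)"
        using less.IH[of "n - 1"] False by simp
      also have "\<dots> \<le> 4 ^ n" by (rule power_increasing) auto
      finally show ?thesis .
    next
      case odd: False
      then obtain m where m: "n = 2 * m + 1" by (elim oddE)
      let ?A = "{p. prime p \<and> p \<le> m + 1}" and ?B = "{p. prime p \<and> m + 1 < p \<and> p \<le> n}"
      have fin: "finite ?A" "finite ?B" by (rule finite_subset[of _ "{..n}"]; auto simp: m)+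
      have "\<Prod>?B dvd n choose m"
      proof -
        have "p dvd n choose m" if "p \<in> ?B" for p
        proof -
          have "p dvd fact n" using that by (simp add: prime_dvd_fact_iff)
          also have "fact n = fact m * fact (Suc m) * (n choose m)"
            using binomial_fact_lemma[of m n] m by (simp add: mult_ac)
          finally show ?thesis
            using that by (auto simp: prime_dvd_mult_iff prime_dvd_fact_iff simp del: fact_Suc)
        qed
        moreover have "(\<forall>p\<in>C. prime p \<and> p dvd n choose m) \<longrightarrow> \<Prod>C dvd n choose m" if "finite C" for C :: "nat set"
          using that
        proof induction
          case (insert p C)
          show ?case
          proof
            assume *: "\<forall>q\<in>insert p C. prime q \<and> q dvd n choose m"
            then have "coprime p (\<Prod>C)"
              using insert.hyps by (intro prod_coprime_right) (metis insertCI primes_coprime)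
            then show "\<Prod>(insert p C) dvd n choose m"
              using insert * by (simp add: divides_mult)
          qed
        qed simp
        ultimately show ?thesis using fin(2) by auto
      qed
      then have B: "\<Prod>?B \<le> 4 ^ m"
        using dvd_imp_le[of "\<Prod>?B" "n choose m"] binomial_odd_le[of m] m by simp
      have "{p. prime p \<and> p \<le> n} = ?A \<union> ?B" using m by auto
      then have "\<Prod>{p. prime p \<and> p \<le> n} = \<Prod>?A * \<Prod>?B"
        using fin by (simp add: prod.union_disjoint disjoint_iff)
      also have "\<dots> \<le> 4 ^ (m + 1) * 4 ^ m"
        using less.IH[of "m + 1"] B False m by (intro mult_mono) auto
      also have "\<dots> = 4 ^ n" by (simp add: m mult_2 flip: power_add)
      finally show ?thesis .
    qed
  qed
qed

lemma finite_primes_le: "finite {p::nat. prime p \<and> p \<le> n}"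
  by (rule finite_subset[of _ "{..n}"]) auto

lemma sum_ln_primes_le: "(\<Sum>p | prime p \<and> p \<le> n. ln (real p)) \<le> real n * ln 4"
proof -
  have "(\<Sum>p | prime p \<and> p \<le> n. ln (real p)) = ln (real (\<Prod>{p. prime p \<and> p \<le> n}))"
    using prime_gt_0_nat by (subst of_nat_prod, subst ln_prod) (auto simp: finite_primes_le)
  also have "\<dots> \<le> ln (4 ^ n)"
  proof (subst ln_le_cancel_iff)
    have "real (\<Prod>{p. prime p \<and> p \<le> n}) \<le> real (4 ^ n)"
      using prod_primes_le of_nat_le_iff by blast
    then show "real (\<Prod>{p. prime p \<and> p \<le> n}) \<le> 4 ^ n" by simp
  qed (auto intro!: prod_pos simp: prime_gt_0_nat)
  also have "\<dots> = real n * ln 4" by (simp add: ln_realpow)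
  finally show ?thesis .
qed

section \<open>Legendre's formula and bounds for the factorial\<close>

text \<open>Double counting of the pairs \<open>(m, k)\<close> with \<open>p ^ k dvd m\<close>.
  Stopping at \<open>k = n\<close> loses nothing: if \<open>p ^ k\<close> divides a positive
  \<open>m \<le> n\<close>, then \<open>k < p ^ k \<le> m \<le> n\<close>.\<close>

lemma multiplicity_fact_prime:
  fixes p :: nat
  assumes "prime p"
  shows "multiplicity p (fact n) = (\<Sum>k=1..n. n div p ^ k)"
proof -
  have "multiplicity p (fact n) = (\<Sum>m=1..n. multiplicity p m)"
    unfolding fact_prod using assms
    by (simp, subst prime_elem_multiplicity_prod_distrib) auto
  also have "\<dots> = (\<Sum>m=1..n. \<Sum>k=1..n. if p ^ k dvd m then 1 else 0)"
  proof (intro sum.cong refl)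
    fix m assume m: "m \<in> {1..n}"
    have iff: "p ^ k dvd m \<longleftrightarrow> k \<le> multiplicity p m" for k
      using m assms by (subst power_dvd_iff_le_multiplicity) auto
    have "multiplicity p m \<le> n"
    proof -
      have "multiplicity p m < p ^ multiplicity p m"
        using assms prime_gt_1_nat by (intro power_gt_expt) auto
      also have "\<dots> \<le> m" using m multiplicity_dvd[of p m] by (intro dvd_imp_le) auto
      finally show ?thesis using m by simp
    qed
    then have "{k \<in> {1..n}. p ^ k dvd m} = {1..multiplicity p m}"
      unfolding iff by auto
    then show "multiplicity p m = (\<Sum>k=1..n. if p ^ k dvd m then 1 else 0)"
      by (subst sum.inter_filter[symmetric]) simp_all
  qed
  also have "\<dots> = (\<Sum>k=1..n. \<Sum>m=1..n. if p ^ k dvd m then 1 else 0)" by (rule sum.swap)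
  also have "\<dots> = (\<Sum>k=1..n. n div p ^ k)"
  proof (intro sum.cong refl)
    fix k assume "k \<in> {1..n}"
    have pos: "p ^ k > 0" using assms prime_gt_0_nat by auto
    have "{m \<in> {1..n}. p ^ k dvd m} = (\<lambda>j. p ^ k * j) ` {1..n div p ^ k}"
    proof (intro equalityI subsetI)
      fix m assume "m \<in> {m \<in> {1..n}. p ^ k dvd m}"
      then obtain j where "m = p ^ k * j" "1 \<le> m" "m \<le> n" by (auto elim!: dvdE simp del: One_nat_def)
      then show "m \<in> (\<lambda>j. p ^ k * j) ` {1..n div p ^ k}"
        using pos by (intro image_eqI[of _ _ j])
          (auto simp: less_eq_div_iff_mult_less_eq mult.commute[of j] Suc_le_eq)
    next
      fix m assume "m \<in> (\<lambda>j. p ^ k * j) ` {1..n div p ^ k}"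
      then obtain j where "m = p ^ k * j" "1 \<le> j" "j \<le> n div p ^ k"
        by (elim imageE) (simp only: atLeastAtMost_iff)
      moreover from this have "j * p ^ k \<le> n"
        using pos by (simp add: less_eq_div_iff_mult_less_eq)
      ultimately show "m \<in> {m \<in> {1..n}. p ^ k dvd m}"
        using pos by (simp add: mult.commute Suc_le_eq)
    qed
    moreover have "inj_on (\<lambda>j. p ^ k * j) {1..n div p ^ k}" using pos by (auto simp: inj_on_def)
    ultimately have "card {m \<in> {1..n}. p ^ k dvd m} = n div p ^ k" by (simp add: card_image)
    then show "(\<Sum>m=1..n. if p ^ k dvd m then 1 else 0) = n div p ^ k"
      by (subst sum.inter_filter[symmetric]) simp_all
  qed
  finally show ?thesis .
qed

lemma multiplicity_fact_ge: "prime (p::nat) \<Longrightarrow> real n / real p - 1 \<le> real (multiplicity p (fact n))"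
proof -
  assume p: "prime p"
  have "real n / real p - 1 \<le> real (n div p)"
    using floor_divide_of_nat_eq[of n p, where ?'a = real] by linarith
  also have "n div p \<le> (\<Sum>k=1..n. n div p ^ k)"
  proof (cases "n = 0")
    case False
    then show ?thesis using member_le_sum[of 1 "{1..n}" "\<lambda>k. n div p ^ k"] by simp
  qed simp
  finally show ?thesis by (simp add: multiplicity_fact_prime[OF p])
qed

lemma multiplicity_fact_le: "prime (p::nat) \<Longrightarrow> real (multiplicity p (fact n)) \<le> real n / (real p - 1)"
proof -
  assume p: "prime p"
  then have p1: "real p > 1" using prime_gt_1_nat by auto
  have "(\<Sum>k=1..n. real (n div p ^ k)) \<le> (\<Sum>k=1..n. real n * (1 / real p) ^ k)"
    by (intro sum_mono) (use of_nat_div_le_of_nat[of n "p ^ _"] in \<open>simp add: power_divide\<close>)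
  also have "\<dots> = real n * (\<Sum>k=1..n. (1 / real p) ^ k)" by (simp add: sum_distrib_left)
  also have "(\<Sum>k=1..n. (1 / real p) ^ k) \<le> 1 / (real p - 1)"
  proof -
    have "(\<Sum>k=1..n. (1 / real p) ^ k) = (1 - (1 / real p) ^ n) / (real p - 1)"
    proof (induction n)
      case (Suc n)
      have "(1 / real p) ^ n - (1 / real p) ^ Suc n = (real p - 1) * (1 / real p) ^ Suc n"
        using p1 by (simp add: field_simps)
      then have "(1 / real p) ^ Suc n = ((1 / real p) ^ n - (1 / real p) ^ Suc n) / (real p - 1)"
        using p1 by (simp add: field_simps del: power_Suc)
      then have "(\<Sum>k=1..Suc n. (1 / real p) ^ k) =
        (1 - (1 / real p) ^ n) / (real p - 1) + ((1 / real p) ^ n - (1 / real p) ^ Suc n) / (real p - 1)"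
        using Suc.IH by simp
      then show ?case by (simp only: add_divide_distrib[symmetric]) simp
    qed simp
    also have "\<dots> \<le> 1 / (real p - 1)" using p1 by (intro divide_right_mono) auto
    finally show ?thesis .
  qed
  finally show ?thesis
    using p by (simp add: multiplicity_fact_prime mult_left_mono)
qed

lemma ln_fact_eq_sum_primes:
  "ln (fact n) = (\<Sum>p | prime p \<and> p \<le> n. real (multiplicity p (fact n)) * ln (real p))"
proof -
  have "prime_factors (fact n :: nat) = {p. prime p \<and> p \<le> n}"
    by (auto simp: prime_factors_dvd prime_dvd_fact_iff)
  then have "(fact n :: nat) = (\<Prod>p | prime p \<and> p \<le> n. p ^ multiplicity p (fact n))"
    using prime_factorization_nat[of "fact n"] by simp
  then have "(fact n :: real) = (\<Prod>p | prime p \<and> p \<le> n. real p ^ multiplicity p (fact n))"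
    by (metis (mono_tags, lifting) of_nat_fact of_nat_power of_nat_prod prod.cong)
  then have "ln (fact n :: real) = (\<Sum>p | prime p \<and> p \<le> n. ln (real p ^ multiplicity p (fact n)))"
    by (simp, subst ln_prod) (auto simp: finite_primes_le prime_gt_0_nat)
  also have "\<dots> = (\<Sum>p | prime p \<and> p \<le> n. real (multiplicity p (fact n)) * ln (real p))"
    by (intro sum.cong refl) (auto simp: ln_realpow prime_gt_0_nat)
  finally show ?thesis .
qed

lemma ln_fact_le: "ln (fact n) \<le> real n * ln (real n)"
proof (cases "n = 0")
  case False
  have "ln (fact n :: real) \<le> ln (real n ^ n)"
    using False fact_le_power[of n, where ?'a = real] by simp
  then show ?thesis using False by (simp add: ln_realpow)
qed simp

text \<open>The quotient \<open>n ^ n / fact n\<close> is a single term of the exponential series at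
  \<open>n\<close>.\<close>

lemma ln_fact_ge: "real n * ln (real n) - real n \<le> ln (fact n)"
proof (cases "n = 0")
  case False
  have "real n ^ n / fact n \<le> exp (real n)"
    using sum_le_suminf[OF summable_exp[of "real n"], of "{n}"]
    by (simp add: exp_def divide_inverse mult.commute)
  then have "ln (real n ^ n / fact n) \<le> real n"
    using False by (metis exp_gt_zero ln_exp ln_le_cancel_iff divide_pos_pos fact_gt_zero of_nat_0_less_iff zero_less_power gr0I)
  then show ?thesis using False by (simp add: ln_div ln_realpow)
qed simp

section \<open>Mertens' first theorem\<close>

text \<open>Bounding the exponent of \<open>p\<close> in \<open>fact n\<close> below by
  \<open>n / p - 1\<close> costs the sum of \<open>ln p\<close> over the primes up to
  \<open>n\<close>, which Chebyshev's bound limits to \<open>n * ln 4\<close>.\<close>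

lemma sum_ln_div_primes_le:
  assumes "n > 0"
  shows "(\<Sum>p | prime p \<and> p \<le> n. ln (real p) / real p) \<le> ln (real n) + ln 4"
proof -
  let ?S = "{p. prime p \<and> p \<le> n}"
  have "real n * (\<Sum>p\<in>?S. ln (real p) / real p) - (\<Sum>p\<in>?S. ln (real p))
      = (\<Sum>p\<in>?S. (real n / real p - 1) * ln (real p))"
    by (simp add: sum_distrib_left sum_subtractf left_diff_distrib)
  also have "\<dots> \<le> (\<Sum>p\<in>?S. real (multiplicity p (fact n)) * ln (real p))"
    using prime_gt_0_nat by (intro sum_mono mult_right_mono multiplicity_fact_ge) (auto simp: Suc_le_eq)
  also have "\<dots> \<le> real n * ln (real n)"
    using ln_fact_le[of n] by (simp add: ln_fact_eq_sum_primes)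
  finally have "real n * (\<Sum>p\<in>?S. ln (real p) / real p) \<le> real n * (ln (real n) + ln 4)"
    using sum_ln_primes_le[of n] by (simp add: distrib_left)
  then show ?thesis using assms by (simp add: mult_le_cancel_left_pos)
qed

text \<open>The 2 added to the logarithm is what makes this telescope: multiplied out, the claim is
  \<open>x * (ln x - ln (x - 1)) \<le> 2\<close>, and the left side is at most
  \<open>x / (x - 1)\<close>.\<close>

lemma ln_div_le_telescope:
  fixes x :: real
  assumes "x \<ge> 2"
  shows "ln x / (x * (x - 1)) \<le> (ln (x - 1) + 2) / (x - 1) - (ln x + 2) / x"
proof -
  have "ln x - ln (x - 1) = ln (x / (x - 1))" using assms by (simp add: ln_div)
  also have "\<dots> \<le> x / (x - 1) - 1" using assms by (intro ln_le_minus_one) simp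
  also have "\<dots> = 1 / (x - 1)" using assms by (simp add: field_simps)
  finally have "x * (ln x - ln (x - 1)) \<le> x * (1 / (x - 1))"
    using assms by (intro mult_left_mono) auto
  also have "\<dots> \<le> 2" using assms by (simp add: field_simps)
  finally have "ln x \<le> (ln (x - 1) + 2) * x - (ln x + 2) * (x - 1)"
    by (simp add: algebra_simps)
  then have "ln x / (x * (x - 1)) \<le> ((ln (x - 1) + 2) * x - (ln x + 2) * (x - 1)) / (x * (x - 1))"
    using assms by (intro divide_right_mono) auto
  also have "\<dots> = (ln (x - 1) + 2) / (x - 1) - (ln x + 2) / x"
    using assms by (simp add: diff_divide_distrib)
  finally show ?thesis .
qed

lemma sum_ln_div_le_2: "(\<Sum>d=2..n. ln (real d) / (real d * (real d - 1))) \<le> 2"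
proof -
  \<comment> \<open>The leading 2 is the value of \<open>(ln x + 2) / x\<close> at
    \<open>x = 1\<close>.\<close>
  have "(\<Sum>d=2..n. ln (real d) / (real d * (real d - 1))) \<le> 2 - (ln (real n) + 2) / real n" if "n \<ge> 1"
    using that
  proof (induction n rule: dec_induct)
    case (step n)
    then show ?case using ln_div_le_telescope[of "real (Suc n)"] by simp
  qed simp
  moreover have "(ln (real n) + 2) / real n \<ge> 0" if "n \<ge> 1" using that by simp
  ultimately show ?thesis by (cases "n \<ge> 1") (linarith, simp)
qed

text \<open>The 3 is 1 from the lower bound for \<open>ln (fact n)\<close> plus 2 from the excess in
  \<open>1 / (p - 1) = 1 / p + 1 / (p * (p - 1))\<close>, summed over all integers instead of
  primes.\<close>

lemma sum_ln_div_primes_ge: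
  assumes "n > 0"
  shows "(\<Sum>p | prime p \<and> p \<le> n. ln (real p) / real p) \<ge> ln (real n) - 3"
proof -
  let ?S = "{p. prime p \<and> p \<le> n}"
  have "real n * ln (real n) - real n \<le> (\<Sum>p\<in>?S. real (multiplicity p (fact n)) * ln (real p))"
    using ln_fact_ge[of n] by (simp add: ln_fact_eq_sum_primes)
  also have "\<dots> \<le> (\<Sum>p\<in>?S. real n / (real p - 1) * ln (real p))"
    using prime_gt_0_nat by (intro sum_mono mult_right_mono multiplicity_fact_le) (auto simp: Suc_le_eq)
  also have "\<dots> = (\<Sum>p\<in>?S. real n * (ln (real p) / real p + ln (real p) / (real p * (real p - 1))))"
  proof (intro sum.cong refl)
    fix p assume "p \<in> ?S"
    then have "real p > 1" using prime_gt_1_nat by auto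
    then show "real n / (real p - 1) * ln (real p) =
        real n * (ln (real p) / real p + ln (real p) / (real p * (real p - 1)))"
      by (simp add: divide_simps) (simp add: algebra_simps)
  qed
  also have "\<dots> = real n * ((\<Sum>p\<in>?S. ln (real p) / real p) + (\<Sum>p\<in>?S. ln (real p) / (real p * (real p - 1))))"
    by (simp add: sum_distrib_left sum.distrib distrib_left)
  finally have "real n * (ln (real n) - 1) \<le>
      real n * ((\<Sum>p\<in>?S. ln (real p) / real p) + (\<Sum>p\<in>?S. ln (real p) / (real p * (real p - 1))))"
    by (simp add: right_diff_distrib)
  then have "ln (real n) - 1 \<le> (\<Sum>p\<in>?S. ln (real p) / real p) + (\<Sum>p\<in>?S. ln (real p) / (real p * (real p - 1)))"
    using assms by (simp add: mult_le_cancel_left_pos)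
  moreover have "(\<Sum>p\<in>?S. ln (real p) / (real p * (real p - 1))) \<le> (\<Sum>d=2..n. ln (real d) / (real d * (real d - 1)))"
    using prime_ge_2_nat by (intro sum_mono2) auto
  ultimately show ?thesis using sum_ln_div_le_2[of n] by linarith
qed

section \<open>Comparison with the powers of two\<close>

text \<open>Abel summation done as an induction: the weighted sum up to \<open>n\<close> is at least
  the plain partial sum times \<open>b n\<close>.\<close>

lemma sum_mult_antimono_nonneg:
  fixes v b :: "nat \<Rightarrow> real"
  assumes partial: "\<And>n. m \<le> n \<Longrightarrow> n \<le> M \<Longrightarrow> (\<Sum>i=m..n. v i) \<ge> 0"
    and anti: "\<And>n. m \<le> n \<Longrightarrow> n < M \<Longrightarrow> b (Suc n) \<le> b n"
    and nonneg: "\<And>n. m \<le> n \<Longrightarrow> n \<le> M \<Longrightarrow> b n \<ge> 0"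
  shows "(\<Sum>i=m..M. v i * b i) \<ge> 0"
proof (cases "m \<le> M")
  case True
  have "(\<Sum>i=m..n. v i * b i) \<ge> (\<Sum>i=m..n. v i) * b n" if "m \<le> n" "n \<le> M" for n
    using that
  proof (induction n rule: dec_induct)
    case (step n)
    have "(\<Sum>i=m..Suc n. v i) * b (Suc n) = (\<Sum>i=m..n. v i) * b (Suc n) + v (Suc n) * b (Suc n)"
      using step.hyps by (simp add: distrib_right)
    also have "\<dots> \<le> (\<Sum>i=m..n. v i) * b n + v (Suc n) * b (Suc n)"
      using step by (intro add_right_mono mult_left_mono partial anti) auto
    also have "\<dots> \<le> (\<Sum>i=m..Suc n. v i * b i)"
      using step by simp
    finally show ?case .
  qed simp
  from this[of M] show ?thesis
    using True partial[of M] nonneg[of M] by (meson mult_nonneg_nonneg order_refl order_trans)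
qed simp

text \<open>Comparing with the step function that is \<open>-B\<close> before \<open>k\<close> and \<open>c\<close> from \<open>k\<close> on.\<close>
lemma sum_mult_antimono_ge:
  fixes v b :: "nat \<Rightarrow> real"
  assumes km: "m < k" "k \<le> M"
    and B: "\<And>n. m \<le> n \<Longrightarrow> n < k \<Longrightarrow> (\<Sum>i=m..n. v i) \<ge> - B"
    and c: "\<And>n. k \<le> n \<Longrightarrow> n \<le> M \<Longrightarrow> (\<Sum>i=m..n. v i) \<ge> c"
    and anti: "\<And>n. m \<le> n \<Longrightarrow> n < M \<Longrightarrow> b (Suc n) \<le> b n"
    and nonneg: "\<And>n. m \<le> n \<Longrightarrow> n \<le> M \<Longrightarrow> b n \<ge> 0"
  shows "(\<Sum>i=m..M. v i * b i) \<ge> c * b k - B * (b m - b k)"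
proof -
  \<comment> \<open>These are the jumps of the step function, so \<open>v - u\<close> has
    nonnegative partial sums.\<close>
  define u where "u i = (if i = m then - B else 0) + (if i = k then c + B else 0)" for i
  have u: "(\<Sum>i=m..n. u i) = (if n < k then - B else c)" if "m \<le> n" for n
    using that km by (simp add: u_def sum.distrib sum.delta)
  have "(\<Sum>i=m..M. (v i - u i) * b i) \<ge> 0"
  proof (rule sum_mult_antimono_nonneg)
    fix n assume "m \<le> n" "n \<le> M"
    then show "(\<Sum>i=m..n. v i - u i) \<ge> 0"
      using B[of n] c[of n] by (simp add: sum_subtractf u)
  qed (use anti nonneg in auto)
  moreover have "(\<Sum>i=m..M. u i * b i) = - B * b m + (c + B) * b k"
  proof -
    have "(\<Sum>i=m..M. u i * b i) = (\<Sum>i=m..M. (if i = m then - B * b i else 0) + (if i = k then (c + B) * b i else 0))"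
      using km by (intro sum.cong refl) (auto simp: u_def)
    then show ?thesis using km by (simp add: sum.distrib sum.delta)
  qed
  ultimately show ?thesis by (simp add: left_diff_distrib sum_subtractf algebra_simps)
qed

section \<open>Powers of two as a model for the primes\<close>

lemma two_power_le_iff_floor_log: "n > 0 \<Longrightarrow> 2 ^ k \<le> n \<longleftrightarrow> k \<le> floor_log n"
proof
  assume "n > 0" "k \<le> floor_log n"
  then show "2 ^ k \<le> n"
    using floor_log_exp2_le[of n] power_increasing[of k "floor_log n" "2::nat"] by linarith
qed (use floor_log_le_iff[of "2 ^ k" n] in simp)

lemma floor_log_mult_ln2_le:
  assumes "n > 0"
  shows "real (floor_log n) * ln 2 \<le> ln (real n)"
proof -
  have "ln (real (2 ^ floor_log n)) \<le> ln (real n)"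
    using assms floor_log_exp2_le[of n] by (subst ln_le_cancel_iff) (auto simp del: of_nat_power)
  then show ?thesis by (simp add: ln_realpow)
qed

text \<open>The power 1 is left out because the weights will be divided by
  \<open>ln d\<close>.\<close>

definition powers2 :: "nat set" where
  "powers2 = {2 ^ k |k. k \<ge> 1}"

lemma sum_powers2:
  assumes "n > 0"
  shows "(\<Sum>d=1..n. if d \<in> powers2 then f d else 0) = (\<Sum>k=1..floor_log n. f (2 ^ k))"
proof -
  have "(\<Sum>d=1..n. if d \<in> powers2 then f d else 0) = sum f {d \<in> {1..n}. d \<in> powers2}"
    by (subst sum.inter_filter) simp_all
  also have "{d \<in> {1..n}. d \<in> powers2} = (\<lambda>k. 2 ^ k) ` {1..floor_log n}"
  proof (rule set_eqI)
    fix d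
    have "d \<in> {d \<in> {1..n}. d \<in> powers2} \<longleftrightarrow> (\<exists>k\<ge>1. d = 2 ^ k \<and> 2 ^ k \<le> n)"
      by (auto simp: powers2_def)
    also have "\<dots> \<longleftrightarrow> d \<in> (\<lambda>k. 2 ^ k) ` {1..floor_log n}"
      unfolding two_power_le_iff_floor_log[OF assms] by auto
    finally show "d \<in> {d \<in> {1..n}. d \<in> powers2} \<longleftrightarrow> d \<in> (\<lambda>k. 2 ^ k) ` {1..floor_log n}" .
  qed
  also have "sum f \<dots> = (\<Sum>k=1..floor_log n. f (2 ^ k))"
    by (subst sum.reindex) (auto simp: inj_on_def)
  finally show ?thesis .
qed

lemma sum_if_prime:
  fixes n :: nat
  shows "(\<Sum>d=1..n. if prime d then f d else 0) = (\<Sum>p | prime p \<and> p \<le> n. f p)"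
proof -
  have "{d \<in> {1..n}. prime d} = {p. prime p \<and> p \<le> n}"
    by (auto dest: prime_ge_1_nat)
  then show ?thesis by (subst sum.inter_filter[symmetric]) simp_all
qed

text \<open>The weight \<open>ln 2\<close> at the powers of 2 imitates the weight \<open>ln p / p\<close> at the primes: both have
  partial sums \<open>ln n + O(1)\<close>. After division by \<open>ln d\<close> the former add up to a harmonic number,
  which is how Euler's constant enters.\<close>
definition prime_dev :: "nat \<Rightarrow> real" where
  "prime_dev d = (if prime d then ln (real d) / real d else 0) - (if d \<in> powers2 then ln 2 else 0)"

text \<open>The powers of 2 contribute between \<open>ln n - ln 2\<close> and \<open>ln n\<close>.
  With Mertens' first theorem the sum lies between \<open>- 3\<close> and
  \<open>ln 4 + ln 2 = 3 * ln 2\<close>.\<close>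

lemma sum_prime_dev_bound:
  assumes "n > 0"
  shows "\<bar>\<Sum>d=1..n. prime_dev d\<bar> \<le> 3"
proof -
  have "(\<Sum>d=1..n. prime_dev d) = (\<Sum>p | prime p \<and> p \<le> n. ln (real p) / real p) - real (floor_log n) * ln 2"
    unfolding prime_dev_def sum_subtractf sum_if_prime using assms by (subst sum_powers2) auto
  moreover have "real (floor_log n) * ln 2 \<le> ln (real n)"
    using assms by (rule floor_log_mult_ln2_le)
  moreover have "ln (real n) \<le> real (floor_log n) * ln 2 + ln 2"
  proof -
    have "ln (real n) \<le> ln (real (2 * 2 ^ floor_log n))"
      using assms floor_log_exp2_ge[of n] by (subst ln_le_cancel_iff) (auto simp del: of_nat_power of_nat_mult)
    then show ?thesis by (simp add: ln_realpow ln_mult)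
  qed
  moreover have "ln (4::real) = 2 * ln 2" using ln_realpow[of "2::real" 2] by simp
  moreover have "ln (2::real) \<le> 1" using ln_2_less_1 by simp
  ultimately show ?thesis
    using sum_ln_div_primes_le[OF assms] sum_ln_div_primes_ge[OF assms] by linarith
qed

text \<open>The function \<open>T n\<close> of the overview; for \<open>n > 0\<close> the harmonic
  number is the sum of \<open>1 / k\<close> over the powers \<open>2 ^ k \<le> n\<close> with
  \<open>k \<ge> 1\<close>.\<close>

definition mertens_diff :: "nat \<Rightarrow> real" where
  "mertens_diff n = (\<Sum>p | prime p \<and> p \<le> n. 1 / real p) - harm (floor_log n)"

text \<open>Since \<open>ln (2 ^ k) = k * ln 2\<close>, division by \<open>ln d\<close> leaves the
  weights \<open>1 / p\<close> and \<open>1 / k\<close>. The factor \<open>g\<close> is 1 for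
  \<open>mertens_diff\<close> and \<open>d powr - s\<close> for its Dirichlet mean.\<close>

lemma sum_prime_dev_div_ln_mult:
  assumes "n > 0"
  shows "(\<Sum>d=1..n. prime_dev d / ln (real d) * g d) =
    (\<Sum>p | prime p \<and> p \<le> n. g p / real p) - (\<Sum>k=1..floor_log n. g (2 ^ k) / real k)"
proof -
  have "prime_dev d / ln (real d) * g d =
      (if prime d then g d / real d else 0) - (if d \<in> powers2 then ln 2 / ln (real d) * g d else 0)" for d
    using prime_gt_1_nat[of d] by (auto simp: prime_dev_def diff_divide_distrib left_diff_distrib)
  then have "(\<Sum>d=1..n. prime_dev d / ln (real d) * g d) =
    (\<Sum>p | prime p \<and> p \<le> n. g p / real p) - (\<Sum>k=1..floor_log n. ln 2 / ln (real (2 ^ k)) * g (2 ^ k))"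
    using assms by (simp only: sum_subtractf sum_if_prime sum_powers2)
  also have "(\<Sum>k=1..floor_log n. ln 2 / ln (real (2 ^ k)) * g (2 ^ k)) = (\<Sum>k=1..floor_log n. g (2 ^ k) / real k)"
    by (intro sum.cong refl) (auto simp: ln_realpow)
  finally show ?thesis .
qed

lemma mertens_diff_eq_sum: "n > 0 \<Longrightarrow> mertens_diff n = (\<Sum>d=1..n. prime_dev d / ln (real d))"
  using sum_prime_dev_div_ln_mult[of n "\<lambda>_. 1"]
  by (simp add: mertens_diff_def harm_def inverse_eq_divide)

text \<open>A block of \<open>prime_dev\<close> from \<open>m + 1\<close> on is a difference of two
  sums bounded by 3, hence at least \<open>- 6\<close>. Adding 6 at \<open>m + 1\<close> makes these
  block sums nonnegative, and Abel summation against \<open>1 / ln d\<close> applies.\<close>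

lemma mertens_diff_almost_mono:
  assumes "0 < m" "m \<le> M"
  shows "mertens_diff M \<ge> mertens_diff m - 6 / ln (real (m + 1))"
proof (cases "m = M")
  case False
  have split: "(\<Sum>d=1..n. f d) = (\<Sum>d=1..m. f d) + (\<Sum>d=m+1..n. f d)" if "m < n" for n and f :: "nat \<Rightarrow> real"
    using that assms sum.ub_add_nat[of 1 m f "n - m"] by simp
  define v where "v d = prime_dev d + (if d = m + 1 then 6 else 0)" for d
  have "(\<Sum>d=m+1..M. v d * (1 / ln (real d))) \<ge> 0"
  proof (rule sum_mult_antimono_nonneg)
    fix n assume n: "m + 1 \<le> n" "n \<le> M"
    have "(\<Sum>d=m+1..n. v d) = (\<Sum>d=m+1..n. prime_dev d) + 6"
      using n by (simp add: v_def sum.distrib sum.delta)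
    then show "(\<Sum>d=m+1..n. v d) \<ge> 0"
      using split[of n prime_dev] sum_prime_dev_bound[of n] sum_prime_dev_bound[of m] n assms by simp
  qed (use assms in \<open>auto intro!: divide_left_mono\<close>)
  also have "(\<Sum>d=m+1..M. v d * (1 / ln (real d))) =
      (\<Sum>d=m+1..M. prime_dev d / ln (real d)) + 6 / ln (real (m + 1))"
  proof -
    have "v d * (1 / ln (real d)) = prime_dev d / ln (real d) + (if d = m + 1 then 6 / ln (real d) else 0)" for d
      by (simp add: v_def add_divide_distrib)
    then show ?thesis using False assms by (simp add: sum.distrib sum.delta)
  qed
  also have "(\<Sum>d=m+1..M. prime_dev d / ln (real d)) = mertens_diff M - mertens_diff m"
    using split[of M "\<lambda>d. prime_dev d / ln (real d)"] False assms by (simp add: mertens_diff_eq_sum)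
  finally show ?thesis by simp
qed simp

section \<open>Euler product\<close>

text \<open>Integral comparison for \<open>t powr - (1 + s)\<close> on \<open>[x, x + 1]\<close>,
  derived from \<open>ln t \<le> t - 1\<close> and \<open>1 + t \<le> exp t\<close> without
  integration.\<close>

lemma powr_telescope:
  fixes x s :: real
  assumes "x > 0" "s > 0"
  shows "s * (x + 1) powr - (1 + s) \<le> x powr - s - (x + 1) powr - s"
proof -
  have "1 + s / (x + 1) \<le> 1 - s * ln (x / (x + 1))"
  proof -
    have "ln (x / (x + 1)) \<le> x / (x + 1) - 1" using assms by (intro ln_le_minus_one) simp
    also have "\<dots> = - 1 / (x + 1)" using assms by (simp add: field_simps)
    finally have "s * ln (x / (x + 1)) \<le> s * (- 1 / (x + 1))" using assms by (intro mult_left_mono) auto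
    then show ?thesis by simp
  qed
  also have "\<dots> \<le> exp (- s * ln (x / (x + 1)))" using exp_ge_add_one_self[of "- s * ln (x / (x + 1))"] by simp
  also have "\<dots> = (x / (x + 1)) powr - s" using assms by (simp add: powr_def)
  also have "\<dots> = x powr - s / (x + 1) powr - s" using assms by (simp add: powr_divide)
  finally have "(1 + s / (x + 1)) * (x + 1) powr - s \<le> x powr - s"
    using assms by (simp add: pos_le_divide_eq)
  moreover have "(x + 1) powr - (1 + s) = (x + 1) powr - s / (x + 1)"
    using assms powr_diff[of "x + 1" "- s" 1] by (simp add: minus_diff_commute)
  ultimately show ?thesis by (simp add: distrib_right)
qed

lemma sum_powr_le:
  assumes "s > 0"
  shows "(\<Sum>n=1..N. real n powr - (1 + s)) \<le> 1 + 1 / s"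
proof -
  have "s * (\<Sum>n=1..N. real n powr - (1 + s)) \<le> s + 1 - real N powr - s" if "N \<ge> 1"
    using that
  proof (induction N rule: dec_induct)
    case (step N)
    then show ?case using powr_telescope[of "real N" s] assms by (simp add: distrib_left add.commute)
  qed (use assms in simp)
  moreover have "real N powr - s \<ge> 0" by simp
  ultimately have "s * (\<Sum>n=1..N. real n powr - (1 + s)) \<le> s + 1"
    using assms by (cases "N \<ge> 1") (linarith, simp)
  also have "\<dots> = s * (1 + 1 / s)" using assms by (simp add: field_simps)
  finally show ?thesis using assms by (simp add: mult_le_cancel_left_pos)
qed

lemma summable_on_powr:
  assumes "s > 0"
  shows "(\<lambda>n::nat. real n powr - (1 + s)) summable_on A"
    and "infsum (\<lambda>n::nat. real n powr - (1 + s)) A \<le> 1 + 1 / s"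
proof -
  have fin: "(\<Sum>n\<in>F. real n powr - (1 + s)) \<le> 1 + 1 / s" if F: "finite F" for F :: "nat set"
  proof -
    have "(\<Sum>n\<in>F. real n powr - (1 + s)) = (\<Sum>n\<in>F - {0}. real n powr - (1 + s))"
      using F by (intro sum.mono_neutral_right) auto
    also have "\<dots> \<le> (\<Sum>n=1..Max (insert 0 F). real n powr - (1 + s))"
      using F by (intro sum_mono2) (auto simp: Suc_le_eq)
    also have "\<dots> \<le> 1 + 1 / s" by (rule sum_powr_le[OF assms])
    finally show ?thesis .
  qed
  show summ: "(\<lambda>n::nat. real n powr - (1 + s)) summable_on A"
    by (rule nonneg_bdd_above_summable_on) (use fin in \<open>auto intro!: bdd_aboveI[of _ "1 + 1 / s"]\<close>)
  show "infsum (\<lambda>n::nat. real n powr - (1 + s)) A \<le> 1 + 1 / s"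
    by (rule infsum_le_finite_sums[OF summ]) (use fin in auto)
qed

text \<open>Sieving one prime at a time: the multiples of \<open>p\<close> removed from the current
  set are \<open>p\<close> times that set, so they carry the fraction
  \<open>p powr - (1 + s)\<close> of its sum.\<close>

lemma infsum_powr_coprime:
  fixes S :: "nat set"
  assumes "s > 0" "finite S" "\<And>p. p \<in> S \<Longrightarrow> prime p"
  shows "infsum (\<lambda>n. real n powr - (1 + s)) {n. n > 0 \<and> (\<forall>p\<in>S. \<not> p dvd n)} =
    (\<Prod>p\<in>S. 1 - real p powr - (1 + s)) * infsum (\<lambda>n::nat. real n powr - (1 + s)) {0<..}"
  using assms(2,3)
proof (induction S)
  case empty
  then show ?case by (simp add: greaterThan_def)
next
  case (insert p S)
  let ?f = "\<lambda>n::nat. real n powr - (1 + s)" and ?R = "\<lambda>S. {n::nat. n > 0 \<and> (\<forall>p\<in>S. \<not> p dvd n)}"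
  have p: "prime p" "p > 0" using insert.prems prime_gt_0_nat by auto
  have "?R S = ?R (insert p S) \<union> (*) p ` ?R S"
  proof (intro equalityI subsetI)
    fix n assume n: "n \<in> ?R S"
    show "n \<in> ?R (insert p S) \<union> (*) p ` ?R S"
    proof (cases "p dvd n")
      case True
      then obtain m where m: "n = p * m" by auto
      then have "m \<in> ?R S" using n by auto
      then show ?thesis using m by blast
    qed (use n in auto)
  next
    fix n assume "n \<in> ?R (insert p S) \<union> (*) p ` ?R S"
    moreover have "\<not> q dvd p * m" if "q \<in> S" "m \<in> ?R S" for q m
    proof -
      have q: "prime q" "q \<noteq> p" using that insert by auto
      then have "\<not> q dvd p" using p primes_dvd_imp_eq by blast
      then show ?thesis using q that by (auto simp: prime_dvd_mult_iff)
    qed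
    ultimately show "n \<in> ?R S" using p by auto
  qed
  then have "infsum ?f (?R S) = infsum ?f (?R (insert p S) \<union> (*) p ` ?R S)" by simp
  also have "\<dots> = infsum ?f (?R (insert p S)) + infsum ?f ((*) p ` ?R S)"
    using assms(1) by (intro infsum_Un_disjoint summable_on_powr) auto
  also have "infsum ?f ((*) p ` ?R S) = infsum (?f \<circ> (*) p) (?R S)"
    using p by (intro infsum_reindex) (auto simp: inj_on_def)
  also have "?f \<circ> (*) p = (\<lambda>n. real p powr - (1 + s) * ?f n)"
    by (auto simp: powr_mult)
  also have "infsum \<dots> (?R S) = real p powr - (1 + s) * infsum ?f (?R S)"
    by (rule infsum_cmult_right') 
  finally have "infsum ?f (?R (insert p S)) = (1 - real p powr - (1 + s)) * infsum ?f (?R S)"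
    by (simp add: left_diff_distrib)
  then show ?case using insert by simp
qed

lemma powr_prime_less_1: "prime (p::nat) \<Longrightarrow> s \<ge> 0 \<Longrightarrow> real p powr - (1 + s) < 1"
  using prime_gt_1_nat[of p] powr_less_mono[of "- (1 + s)" 0 "real p"] by simp

text \<open>The number 1 survives the sieve, so the sifted sum is at least 1; take
  logarithms.\<close>

lemma sum_ln_euler_factors_le:
  fixes S :: "nat set"
  assumes s: "s > 0" and S: "finite S" "\<And>p. p \<in> S \<Longrightarrow> prime p"
  shows "(\<Sum>p\<in>S. - ln (1 - real p powr - (1 + s))) \<le> ln (1 + 1 / s)"
proof -
  let ?f = "\<lambda>n::nat. real n powr - (1 + s)" and ?R = "{n::nat. n > 0 \<and> (\<forall>p\<in>S. \<not> p dvd n)}"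
  let ?P = "\<Prod>p\<in>S. 1 - ?f p"
  have fac: "1 - ?f p > 0" if "p \<in> S" for p
    using powr_prime_less_1[OF S(2)[OF that]] s by simp
  then have ne: "1 - ?f p \<noteq> 0" if "p \<in> S" for p
    using that by fastforce
  have P: "?P > 0" using fac by (intro prod_pos) auto
  have "1 = sum ?f {1}" by simp
  also have "\<dots> \<le> infsum ?f ?R"
    using S(2) not_prime_1 by (intro finite_sum_le_infsum summable_on_powr[OF s]) force+
  also have "\<dots> = ?P * infsum ?f {0<..}" by (rule infsum_powr_coprime[OF assms])
  also have "\<dots> \<le> ?P * (1 + 1 / s)"
    using P by (intro mult_left_mono summable_on_powr[OF s]) auto
  finally have "ln 1 \<le> ln (?P * (1 + 1 / s))"
    by (subst ln_le_cancel_iff) auto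
  also have "\<dots> = ln ?P + ln (1 + 1 / s)"
    using P s by (intro ln_mult_pos) (auto simp: add_pos_pos)
  also have "ln ?P = (\<Sum>p\<in>S. ln (1 - ?f p))"
    using S ne by (intro ln_prod) auto
  finally show ?thesis by (simp add: sum_negf)
qed

section \<open>Mertens' third theorem, upper bound\<close>

lemma sums_neg_ln_one_minus:
  fixes x :: real
  assumes "0 < x" "x < 1"
  shows "(\<lambda>K. \<Sum>k=1..K. x ^ k / real k) \<longlonglongrightarrow> - ln (1 - x)"
proof -
  have "(\<lambda>n. - (x ^ n / real n)) sums ln (1 - x)"
    using ln_series'[of "- x"] assms by simp
  from sums_minus[OF this] have "(\<lambda>K. \<Sum>k=0..K. x ^ k / real k) \<longlonglongrightarrow> - ln (1 - x)"
    by (simp add: sums_def')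
  \<comment> \<open>The term \<open>k = 0\<close> is a division by zero, hence 0.\<close>
  then show ?thesis by (simp add: sum.atLeast_Suc_atMost)
qed

text \<open>
  Abel summation of \<open>prime_dev d / ln d\<close> against \<open>d powr - s\<close>. Only the primes up to \<open>n\<close> keep their full
  Euler factors, so that \<open>s\<close> can tend to 0 in a finite sum; the other primes lose nonnegative terms.
\<close>
lemma mertens_diff_laplace_bound:
  fixes s c :: real
  assumes s: "s > 0" and n: "n \<ge> 2" and c: "\<And>m. m \<ge> n \<Longrightarrow> mertens_diff m \<ge> c"
    and B: "\<And>m. m > 0 \<Longrightarrow> mertens_diff m \<ge> - B"
  shows "c * real n powr - s - B * (1 - real n powr - s)
      + (\<Sum>p | prime p \<and> p \<le> n. - ln (1 - real p powr - (1 + s)) - real p powr - (1 + s))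
    \<le> ln (1 + 1 / s) + ln (1 - 2 powr - s)"
proof -
  let ?L = "c * real n powr - s - B * (1 - real n powr - s)
      + (\<Sum>p | prime p \<and> p \<le> n. - ln (1 - real p powr - (1 + s)) - real p powr - (1 + s))"
  have main: "?L \<le> ln (1 + 1 / s) - (\<Sum>k=1..K. (2 powr - s) ^ k / real k)" if K: "K \<ge> n" for K
  proof -
    \<comment> \<open>With this cutoff \<open>floor_log M = K\<close>, so the powers of 2 give
      exactly the \<open>K\<close>-th partial sum of the logarithm series.\<close>
    define M :: nat where "M = 2 ^ K"
    have M: "n \<le> M" "M > 0"
      using order.trans[OF K less_imp_le[OF less_exp]] by (auto simp: M_def)
    \<comment> \<open>The partial sums of \<open>prime_dev d / ln d\<close> are the values of
      \<open>mertens_diff\<close>: at least \<open>- B\<close> before \<open>n\<close>, at least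
      \<open>c\<close> from \<open>n\<close> on.\<close>
    have "c * real n powr - s - B * (real 1 powr - s - real n powr - s) \<le>
        (\<Sum>d=1..M. prime_dev d / ln (real d) * real d powr - s)"
    proof (rule sum_mult_antimono_ge)
      fix m assume "1 \<le> m" "m < n"
      then show "- B \<le> (\<Sum>d=1..m. prime_dev d / ln (real d))"
        using B[of m] mertens_diff_eq_sum[of m] by simp
    next
      fix m assume "n \<le> m" "m \<le> M"
      then show "c \<le> (\<Sum>d=1..m. prime_dev d / ln (real d))"
        using c[of m] mertens_diff_eq_sum[of m] n by simp
    qed (use s n M in \<open>auto intro!: powr_mono2'\<close>)
    also have "\<dots> = (\<Sum>p | prime p \<and> p \<le> M. real p powr - s / real p) -
        (\<Sum>k=1..floor_log M. real (2 ^ k) powr - s / real k)"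
      by (rule sum_prime_dev_div_ln_mult[OF M(2)])
    also have "(\<Sum>p | prime p \<and> p \<le> M. real p powr - s / real p) = (\<Sum>p | prime p \<and> p \<le> M. real p powr - (1 + s))"
    proof (intro sum.cong refl)
      fix p assume "p \<in> {p. prime p \<and> p \<le> M}"
      then have "p > 0" using prime_gt_0_nat by auto
      then show "real p powr - s / real p = real p powr - (1 + s)"
        using powr_diff[of "real p" "- s" 1] by (simp add: minus_diff_commute)
    qed
    also have "(\<Sum>k=1..floor_log M. real (2 ^ k) powr - s / real k) = (\<Sum>k=1..K. (2 powr - s) ^ k / real k)"
      by (simp add: M_def powr_power powr_powr flip: powr_realpow) (simp add: mult.commute)
    finally have 1: "c * real n powr - s - B * (1 - real n powr - s) \<le>
      (\<Sum>p | prime p \<and> p \<le> M. real p powr - (1 + s)) - (\<Sum>k=1..K. (2 powr - s) ^ k / real k)"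
      by simp
    have "(\<Sum>p | prime p \<and> p \<le> n. - ln (1 - real p powr - (1 + s)) - real p powr - (1 + s))
      \<le> (\<Sum>p | prime p \<and> p \<le> M. - ln (1 - real p powr - (1 + s)) - real p powr - (1 + s))"
    proof (rule sum_mono2[OF finite_primes_le])
      fix p assume "p \<in> {p. prime p \<and> p \<le> M} - {p. prime p \<and> p \<le> n}"
      then have "real p powr - (1 + s) < 1" using s by (intro powr_prime_less_1) auto
      then show "0 \<le> - ln (1 - real p powr - (1 + s)) - real p powr - (1 + s)"
        using ln_le_minus_one[of "1 - real p powr - (1 + s)"] by simp
    qed (use M in auto)
    also have "\<dots> \<le> ln (1 + 1 / s) - (\<Sum>p | prime p \<and> p \<le> M. real p powr - (1 + s))"
      using sum_ln_euler_factors_le[OF s finite_primes_le[of M]] by (simp add: sum_subtractf)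
    finally show ?thesis using 1 by linarith
  qed
  have "(\<lambda>K. ln (1 + 1 / s) - (\<Sum>k=1..K. (2 powr - s) ^ k / real k))
      \<longlonglongrightarrow> ln (1 + 1 / s) - - ln (1 - 2 powr - s)"
    using s powr_less_mono[of "- s" 0 2] by (intro tendsto_intros sums_neg_ln_one_minus) auto
  then show ?thesis
    using main by (intro LIMSEQ_le_const[of _ "_ + _"]) auto
qed

text \<open>Let \<open>s\<close> tend to 0 from the right in the preceding bound. The
  \<open>B\<close> term vanishes, and the right side tends to \<open>ln (ln 2)\<close> because
  \<open>1 - 2 powr - s\<close> behaves like \<open>s * ln 2\<close>. Inserting \<open>c\<close>
  cancels the sum of \<open>1 / p\<close>.\<close>

lemma sum_ln_prime_factors_le_harm:
  assumes "n \<ge> 2"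
  shows "(\<Sum>p | prime p \<and> p \<le> n. - ln (1 - 1 / real p)) \<le>
    harm (floor_log n) + ln (ln 2) + 6 / ln (real (n + 1))"
proof -
  \<comment> \<open>Both come from almost monotonicity, started at \<open>n\<close> for
    \<open>c\<close> and at 1, where \<open>mertens_diff\<close> is 0, for \<open>B\<close>.\<close>
  define c B where "c = mertens_diff n - 6 / ln (real (n + 1))" and "B = 6 / ln (2::real)"
  have *: "c * real n powr - s - B * (1 - real n powr - s)
      + (\<Sum>p | prime p \<and> p \<le> n. - ln (1 - real p powr - (1 + s)) - real p powr - (1 + s))
    \<le> ln (1 + 1 / s) + ln (1 - 2 powr - s)" if "s > 0" for s
  proof (rule mertens_diff_laplace_bound[OF that assms])
    fix m assume "n \<le> m"
    then show "c \<le> mertens_diff m"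
      unfolding c_def using assms by (intro mertens_diff_almost_mono) auto
  next
    fix m :: nat assume "m > 0"
    moreover have "mertens_diff 1 = 0"
      by (auto simp: mertens_diff_def harm_def intro!: sum.neutral dest: prime_gt_1_nat)
    ultimately show "- B \<le> mertens_diff m"
      unfolding B_def using mertens_diff_almost_mono[of 1 m] by simp
  qed
  let ?g = "\<lambda>s::real. c * real n powr - s - B * (1 - real n powr - s)
      + (\<Sum>p | prime p \<and> p \<le> n. - ln (1 - real p powr - (1 + s)) - real p powr - (1 + s))"
  have "(?g \<longlongrightarrow> c * real n powr - 0 - B * (1 - real n powr - 0)
      + (\<Sum>p | prime p \<and> p \<le> n. - ln (1 - real p powr - (1 + 0)) - real p powr - (1 + 0))) (at_right 0)"
  proof (intro tendsto_intros)
    fix p assume "p \<in> {p. prime p \<and> p \<le> n}"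
    then have "real p powr - (1 + 0) < 1" by (intro powr_prime_less_1) auto
    then show "1 - real p powr - (1 + 0) \<noteq> 0" by linarith
  qed (use assms prime_gt_0_nat in auto)
  moreover have "((\<lambda>s::real. ln (1 + 1 / s) + ln (1 - 2 powr - s)) \<longlongrightarrow> ln (ln 2)) (at_right 0)"
    by real_asymp
  moreover have "eventually (\<lambda>s. ?g s \<le> ln (1 + 1 / s) + ln (1 - 2 powr - s)) (at_right 0)"
    using * eventually_at_right_less[of 0] by (auto elim!: eventually_mono)
  ultimately have "c * real n powr - 0 - B * (1 - real n powr - 0)
      + (\<Sum>p | prime p \<and> p \<le> n. - ln (1 - real p powr - (1 + 0)) - real p powr - (1 + 0)) \<le> ln (ln 2)"
    by (intro tendsto_le[of "at_right (0::real)" _ _ ?g]) auto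
  also have "(\<Sum>p | prime p \<and> p \<le> n. - ln (1 - real p powr - (1 + 0)) - real p powr - (1 + 0)) =
      (\<Sum>p | prime p \<and> p \<le> n. - ln (1 - 1 / real p)) - (\<Sum>p | prime p \<and> p \<le> n. 1 / real p)"
    unfolding sum_subtractf[symmetric]
    by (intro sum.cong refl) (auto simp: powr_minus_divide)
  finally show ?thesis
    using assms by (simp add: c_def mertens_diff_def)
qed

text \<open>With \<open>K = floor_log n\<close>, the harmonic number is
  \<open>ln K + euler_mascheroni + o(1)\<close>, and \<open>ln K + ln (ln 2) \<le> ln (ln n)\<close>
  since \<open>2 ^ K \<le> n\<close>.\<close>

theorem mertens_third_upper:
  assumes "e > 0"
  shows "eventually (\<lambda>n. (\<Sum>p | prime p \<and> p \<le> n. - ln (1 - 1 / real p)) \<le>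
    ln (ln (real n)) + euler_mascheroni + e) sequentially"
proof -
  have fl: "filterlim floor_log at_top sequentially"
    unfolding filterlim_at_top
  proof (intro allI)
    fix k
    show "eventually (\<lambda>n. k \<le> floor_log n) sequentially"
      using eventually_ge_at_top[of "2 ^ k"]
      by eventually_elim (use floor_log_le_iff[of "2 ^ k"] in simp)
  qed
  have "(\<lambda>n. (harm (floor_log n) - ln (real (floor_log n))) + 6 / ln (real (n + 1))) \<longlonglongrightarrow> euler_mascheroni + 0"
    by (intro tendsto_add filterlim_compose[OF euler_mascheroni_LIMSEQ fl]) real_asymp
  then have ev: "eventually (\<lambda>n. (harm (floor_log n) - ln (real (floor_log n))) + 6 / ln (real (n + 1)) < euler_mascheroni + e) sequentially"
    using assms by (intro order_tendstoD(2)) auto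
  show ?thesis
    using ev eventually_ge_at_top[of 2]
  proof eventually_elim
    case (elim n)
    have "floor_log n \<ge> 1" using elim floor_log_le_iff[of 2 n] floor_log_power[of 1] by simp
    moreover have "real (floor_log n) * ln 2 \<le> ln (real n)"
      using elim by (intro floor_log_mult_ln2_le) simp
    ultimately have "ln (real (floor_log n) * ln 2) \<le> ln (ln (real n))"
      using elim by (subst ln_le_cancel_iff) auto
    then have "ln (real (floor_log n)) + ln (ln 2) \<le> ln (ln (real n))"
      using \<open>floor_log n \<ge> 1\<close> by (subst (asm) ln_mult_pos) auto
    then show ?case using sum_ln_prime_factors_le_harm[of n] elim by linarith
  qed
qed

section \<open>Gronwall's theorem, upper bound\<close>

lemma sigma_div_eq:
  assumes "n > 0"
  shows "real (sigma n) / real n = (\<Sum>d | d dvd n. 1 / real d)"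
proof -
  have "real (sigma n) / real n = (\<Sum>d | d dvd n. real d / real n)"
    by (simp add: sigma_def sum_divide_distrib)
  also have "\<dots> = (\<Sum>d | d dvd n. 1 / real d)"
    by (rule sum.reindex_bij_witness[of _ "\<lambda>d. n div d" "\<lambda>d. n div d"])
      (use assms in \<open>auto simp: real_of_nat_div field_simps\<close>)
  finally show ?thesis .
qed

text \<open>The sieve again, now on the divisors of \<open>n\<close>. Only an inequality results,
  because \<open>p * m\<close> need not divide \<open>n\<close> when \<open>m\<close> does.\<close>

lemma sum_coprime_divisors_ge:
  assumes "n > 0" "finite S" "\<And>p. p \<in> S \<Longrightarrow> prime p"
  shows "(\<Sum>d | d dvd n \<and> (\<forall>p\<in>S. \<not> p dvd d). 1 / real d) \<ge>
    (\<Prod>p\<in>S. 1 - 1 / real p) * (\<Sum>d | d dvd n. 1 / real d)"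
  using assms(2,3)
proof (induction S)
  case (insert p S)
  let ?D = "\<lambda>S. {d. d dvd n \<and> (\<forall>p\<in>S. \<not> p dvd d)}" and ?f = "\<lambda>d::nat. 1 / real d"
  have fin: "finite {d. d dvd n \<and> Q d}" for Q using assms(1) by simp
  have p: "p > 1" using insert.prems prime_gt_1_nat by auto
  have "sum ?f (?D S) \<le> sum ?f (?D (insert p S) \<union> (*) p ` ?D S)"
  proof (rule sum_mono2)
    show "?D S \<subseteq> ?D (insert p S) \<union> (*) p ` ?D S"
    proof
      fix d assume d: "d \<in> ?D S"
      show "d \<in> ?D (insert p S) \<union> (*) p ` ?D S"
      proof (cases "p dvd d")
        case True
        then obtain m where m: "d = p * m" by auto
        then have "m \<in> ?D S" using d dvd_trans[of m d n] by auto
        then show ?thesis using m by blast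
      qed (use d in auto)
    qed
  qed (use fin in auto)
  also have "\<dots> = sum ?f (?D (insert p S)) + sum ?f ((*) p ` ?D S)"
    using fin by (intro sum.union_disjoint) auto
  also have "sum ?f ((*) p ` ?D S) = 1 / real p * sum ?f (?D S)"
    using p by (subst sum.reindex) (auto simp: inj_on_def sum_distrib_left)
  finally have "(1 - 1 / real p) * sum ?f (?D S) \<le> sum ?f (?D (insert p S))"
    by (simp add: left_diff_distrib)
  moreover have "(1 - 1 / real p) * ((\<Prod>p\<in>S. 1 - 1 / real p) * (\<Sum>d | d dvd n. 1 / real d)) \<le> (1 - 1 / real p) * sum ?f (?D S)"
    using insert p by (intro mult_left_mono) auto
  ultimately show ?case using insert.hyps by (simp add: mult.assoc)
qed simp

text \<open>Sieving by all prime factors of \<open>n\<close> leaves only the divisor 1.\<close>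

lemma sigma_div_le:
  assumes "n > 0"
  shows "real (sigma n) / real n \<le> exp (\<Sum>p\<in>prime_factors n. - ln (1 - 1 / real p))"
proof -
  let ?S = "prime_factors n"
  have pos: "1 - 1 / real p > 0" if "p \<in> ?S" for p
  proof -
    have "p > 1" using that in_prime_factors_imp_prime prime_gt_1_nat by blast
    then show ?thesis by simp
  qed
  have "{d. d dvd n \<and> (\<forall>p\<in>?S. \<not> p dvd d)} = {1}"
  proof (intro equalityI subsetI)
    fix d assume d: "d \<in> {d. d dvd n \<and> (\<forall>p\<in>?S. \<not> p dvd d)}"
    show "d \<in> {1}"
    proof (rule ccontr)
      assume "d \<notin> {1}"
      then obtain p where p: "prime p" "p dvd d" using prime_factor_nat[of d] by auto
      then have "p \<in> ?S" using d assms by (auto simp: prime_factors_dvd intro: dvd_trans)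
      then show False using d p by auto
    qed
  qed (auto dest: in_prime_factors_imp_prime)
  then have "(\<Prod>p\<in>?S. 1 - 1 / real p) * (real (sigma n) / real n) \<le> 1"
    using sum_coprime_divisors_ge[OF assms, of ?S] sigma_div_eq[OF assms] by auto
  moreover have "(\<Prod>p\<in>?S. 1 - 1 / real p) = exp (- (\<Sum>p\<in>?S. - ln (1 - 1 / real p)))"
    using pos by (simp add: sum_negf exp_sum)
  ultimately have "real (sigma n) / real n / exp (\<Sum>p\<in>?S. - ln (1 - 1 / real p)) \<le> 1"
    by (simp only: exp_minus) (simp add: field_simps)
  then show ?thesis by (subst (asm) pos_divide_le_eq) simp_all
qed

text \<open>The product of the prime factors above \<open>y\<close> is at most
  \<open>n\<close>.\<close>

lemma card_large_prime_factors:
  assumes "n > 0" "y > 1"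
  shows "real (card {p \<in> prime_factors n. real p > y}) * ln y \<le> ln (real n)"
proof -
  let ?B = "{p \<in> prime_factors n. real p > y}"
  have "y ^ card ?B = (\<Prod>p\<in>?B. y)" by simp
  also have "\<dots> \<le> (\<Prod>p\<in>?B. real p)" using assms by (intro prod_mono) auto
  also have "\<dots> \<le> (\<Prod>p\<in>prime_factors n. real p)"
    by (intro prod_mono2) (auto dest!: in_prime_factors_imp_prime prime_ge_1_nat)
  also have "\<dots> \<le> (\<Prod>p\<in>prime_factors n. real p ^ multiplicity p n)"
    by (intro prod_mono conjI self_le_power) (auto simp: prime_factors_multiplicity dest: prime_ge_1_nat)
  also have "\<dots> = real n"
    using prime_factorization_nat[OF assms(1)] by (metis (mono_tags, lifting) of_nat_power of_nat_prod prod.cong)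
  finally have "ln (y ^ card ?B) \<le> ln (real n)"
    using assms by (subst ln_le_cancel_iff) auto
  then show ?thesis using assms by (simp add: ln_realpow)
qed

theorem gronwall_upper:
  assumes "e > 0"
  shows "eventually (\<lambda>n. X n \<le> exp (euler_mascheroni + e)) sequentially"
proof -
  define N where "N n = nat \<lfloor>ln (real n)\<rfloor>" for n
  have N: "filterlim N at_top sequentially"
    unfolding N_def
    by (rule filterlim_compose[OF filterlim_nat_sequentially], rule filterlim_compose[OF filterlim_floor_sequentially]) real_asymp
  have "eventually (\<lambda>n. (\<Sum>p | prime p \<and> p \<le> N n. - ln (1 - 1 / real p)) \<le>
      ln (ln (real (N n))) + euler_mascheroni + e / 2) sequentially"
    using mertens_third_upper[of "e / 2"] N assms by (auto dest!: eventually_compose_filterlim)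
  \<comment> \<open>At most \<open>ln n / ln (ln n)\<close> prime factors exceed
    \<open>ln n\<close>, and each adds at most \<open>1 / (ln n - 1)\<close> to the
    exponent.\<close>
  moreover have "eventually (\<lambda>n. ln (real n) / ln (ln (real n)) * (1 / (ln (real n) - 1)) < e / 2) sequentially"
  proof (rule order_tendstoD(2))
    show "(\<lambda>n. ln (real n) / ln (ln (real n)) * (1 / (ln (real n) - 1))) \<longlonglongrightarrow> 0" by real_asymp
  qed (use assms in simp)
  moreover have "eventually (\<lambda>n. ln (real n) > 2) sequentially" by real_asymp
  moreover have "eventually (\<lambda>n. N n \<ge> 2) sequentially"
    using N filterlim_at_top by blast
  ultimately show ?thesis
  proof eventually_elim
    case (elim n)
    let ?y = "ln (real n)" and ?f = "\<lambda>p::nat. - ln (1 - 1 / real p)"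
    let ?A = "{p \<in> prime_factors n. real p \<le> ?y}" and ?B = "{p \<in> prime_factors n. real p > ?y}"
    have n: "n > 0" using elim by (cases n) auto
    have Ny: "real (N n) \<le> ?y" using elim by (simp add: N_def)
    have fpos: "?f p \<ge> 0" if "prime p" for p
      using prime_gt_1_nat[OF that] by simp
    have "prime_factors n = ?A \<union> ?B" by auto
    then have "sum ?f (prime_factors n) = sum ?f ?A + sum ?f ?B"
      by (subst \<open>prime_factors n = _\<close>, subst sum.union_disjoint) auto
    also have "sum ?f ?A \<le> (\<Sum>p | prime p \<and> p \<le> N n. ?f p)"
    proof (rule sum_mono2[OF finite_primes_le])
      show "?A \<subseteq> {p. prime p \<and> p \<le> N n}"
        by (auto simp: N_def le_nat_floor intro: in_prime_factors_imp_prime)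
    qed (use fpos in auto)
    also have "sum ?f ?B \<le> (\<Sum>p\<in>?B. 1 / (?y - 1))"
    proof (rule sum_mono)
      fix p assume "p \<in> ?B"
      then have p: "real p > ?y" by simp
      have "?f p = ln (real p / (real p - 1))"
        using p elim by (simp add: ln_div field_simps)
      also have "\<dots> \<le> real p / (real p - 1) - 1" using p elim by (intro ln_le_minus_one) auto
      also have "\<dots> = 1 / (real p - 1)" using p elim by (simp add: field_simps)
      also have "\<dots> \<le> 1 / (?y - 1)" using p elim by (intro divide_left_mono) auto
      finally show "?f p \<le> 1 / (?y - 1)" .
    qed
    also have "\<dots> = real (card ?B) * (1 / (?y - 1))" by simp
    also have "\<dots> \<le> ?y / ln ?y * (1 / (?y - 1))"
    proof (rule mult_right_mono)
      show "real (card ?B) \<le> ?y / ln ?y"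
        using card_large_prime_factors[OF n, of ?y] elim by (simp add: pos_le_divide_eq)
    qed (use elim in simp)
    also have "\<dots> \<le> e / 2" using elim by simp
    also have "(\<Sum>p | prime p \<and> p \<le> N n. ?f p) \<le> ln (ln (real (N n))) + euler_mascheroni + e / 2"
      using elim by simp
    also have "ln (ln (real (N n))) \<le> ln (ln ?y)"
      using elim Ny by simp
    finally have sum_le: "sum ?f (prime_factors n) \<le> ln (ln ?y) + (euler_mascheroni + e)" by simp
    have "real (sigma n) / real n \<le> exp (ln (ln ?y) + (euler_mascheroni + e))"
      using sigma_div_le[OF n] sum_le by (meson exp_le_cancel_iff order.trans)
    also have "\<dots> = ln ?y * exp (euler_mascheroni + e)"
      using elim by (subst exp_add) simp
    finally have "real (sigma n) / real n / ln ?y \<le> exp (euler_mascheroni + e)"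
      using elim by (subst pos_divide_le_eq) (auto simp: mult.commute)
    then show "X n \<le> exp (euler_mascheroni + e)" by (simp add: X_def)
  qed
qed

section \<open>Maximality argument\<close>

theorem theorem7:
  assumes "\<forall>n::nat. n > 5040 \<longrightarrow> (\<exists>x::nat. x > 0 \<and> X (n * x) > X n)"
  shows "\<forall>n::nat. n > 5040 \<longrightarrow> X n < exp (euler_mascheroni :: real)"
proof (intro allI impI, rule ccontr)
  fix n :: nat assume n: "n > 5040" and "\<not> X n < exp (euler_mascheroni :: real)"
  then obtain x where x: "x > 0" "X (n * x) > exp euler_mascheroni"
    using assms by (meson not_less order.strict_trans1)
  \<comment> \<open>\<open>X n\<close> itself may equal \<open>exp euler_mascheroni\<close>; the
    strictly larger value at \<open>n * x\<close> leaves room for a positive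
    \<open>e\<close>.\<close>
  define c where "c = X (n * x)"
  \<comment> \<open>Half the gap, so that \<open>exp (euler_mascheroni + e)\<close> stays strictly
    below \<open>c\<close>.\<close>
  define e where "e = (ln c - euler_mascheroni) / 2"
  have "c > 0" using x(2) by (simp add: c_def order.strict_trans[OF exp_gt_zero])
  have "ln (exp euler_mascheroni) < ln c"
    using x(2) \<open>c > 0\<close> by (subst ln_less_cancel_iff) (simp_all add: c_def)
  then have "e > 0" by (simp add: e_def)
  have "exp (euler_mascheroni + e) < exp (ln c)"
    using \<open>e > 0\<close> by (simp add: e_def field_simps)
  then have less: "exp (euler_mascheroni + e) < c" using \<open>c > 0\<close> by simp
  obtain n0 where n0: "\<And>m. m \<ge> n0 \<Longrightarrow> X m \<le> exp (euler_mascheroni + e)"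
    using gronwall_upper[OF \<open>e > 0\<close>] by (auto simp: eventually_sequentially)
  define A where "A = {m. m > 5040 \<and> X m \<ge> c}"
  have "A \<subseteq> {..<n0}" using n0 less by (force simp: A_def not_less[symmetric])
  then have "finite A" by (rule finite_subset) simp
  have "n * x \<ge> n" using x(1) by simp
  with n have "n * x > 5040" by (rule less_le_trans)
  then have "n * x \<in> A" by (simp add: A_def c_def)
  then have "Max (X ` A) \<in> X ` A" using \<open>finite A\<close> by (intro Max_in) auto
  then obtain m where m: "m \<in> A" "X m = Max (X ` A)" by auto
  then obtain y where y: "y > 0" "X (m * y) > X m" using assms by (auto simp: A_def)
  have "5040 < m" "c \<le> X m" using m(1) by (auto simp: A_def)
  moreover have "m \<le> m * y" using y(1) by simp
  ultimately have "m * y \<in> A" using y(2) by (simp only: A_def mem_Collect_eq) linarith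
  then have "X (m * y) \<le> Max (X ` A)" using \<open>finite A\<close> by (intro Max_ge) auto
  then show False using m(2) y(2) by simp
qed

end
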